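(* Let $m>2$ and $n\geq 1$ be integers, and let $P(m,n)$ be the directed prefix-reversal graph. Then every integer in the set $[0,n]\setminus\{\lfloor n/2\rfloor\}$ belongs to the spectrum of $P(m,n)$.
   Context: For integers $a<b$, $[a,b]=\{a,a+1,\ldots,b\}$, and $[n]=\{1,\ldots,n\}$. Let $C_m=\{0,1,\ldots,m-1\}$ be the cyclic group of order $m$, written additively, and let $S(m,n)=C_m\wr S_n$ be the group of colored permutations. An element of $S(m,n)$ is written $\pi=\pi_1^{e_1}\pi_2^{e_2}\cdots\pi_n^{e_n}$, where $\pi_1\pi_2\cdots\pi_n$ is a permutation of $[n]$ in one-line notation and $e_1,\ldots,e_n\in C_m$ are the colors attached to the symbols. For $i\in[n]$, the $i$-th flip $r_i^+$ acts by $$r_i^{+}(\pi_1^{e_1}\cdots\pi_n^{e_n})=\pi_i^{e_i+1}\pi_{i-1}^{e_{i-1}+1}\cdots\pi_1^{e_1+1}\pi_{i+1}^{e_{i+1}}\cdots\pi_n^{e_n},$$ with colors taken mod $m$. Let $R_n^{+}=\{r_i^+: i\in[n]\}$. The directed prefix-reversal graph $P(m,n)$ has vertex set $S(m,n)$ and set of directed edges $\{(v,r(v)): v\in S(m,n),\ r\in R_n^{+}\}$ (a Cayley graph of $S(m,n)$). The spectrum of a (directed) graph is the set of (complex) eigenvalues, with multiplicities, of its adjacency matrix $A$, where $A_{u,v}=1$ if $(u,v)$ is an edge and $A_{u,v}=0$ otherwise. *)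

theory Defs
  imports
    "HOL-Combinatorics.Multiset_Permutations"
    "Jordan_Normal_Form.Spectral_Radius"
    "Graph_Theory.Pair_Digraph"
begin

text \<open>
  A colored permutation is given in one-line notation: the list
  \<open>[(p 1, e 1), \<dots>, (p n, e n)]\<close> stands for the word whose \<open>i\<close>-th symbol is \<open>p i\<close>,
  carrying the color \<open>e i\<close>. The cyclic group of order \<open>m\<close> is \<open>{0..<m}\<close> with addition
  modulo \<open>m\<close>.
\<close>

type_synonym colored_word = "(nat \<times> nat) list"

definition colored_perms :: "nat \<Rightarrow> nat \<Rightarrow> colored_word set" where
  "colored_perms m n =
     {w. map fst w \<in> permutations_of_set {1..n} \<and> set (map snd w) \<subseteq> {0..<m}}"

definition flip :: "nat \<Rightarrow> nat \<Rightarrow> colored_word \<Rightarrow> colored_word" where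
  "flip m i w = rev (map (\<lambda>(p, e). (p, (e + 1) mod m)) (take i w)) @ drop i w"

definition prefix_reversal_graph :: "nat \<Rightarrow> nat \<Rightarrow> colored_word pair_pre_digraph" where
  "prefix_reversal_graph m n =
     \<lparr> pverts = colored_perms m n,
       parcs = {(w, flip m i w) | w i. w \<in> colored_perms m n \<and> i \<in> {1..n}} \<rparr>"

text \<open>
  Matrices are indexed by natural numbers, so the adjacency matrix is taken with respect
  to a list \<open>vs\<close> enumerating the vertices. Changing the enumeration conjugates
  the matrix by a permutation matrix.
\<close>

definition adjacency_matrix :: "'a pair_pre_digraph \<Rightarrow> 'a list \<Rightarrow> complex mat" where
  "adjacency_matrix G vs =
     mat (length vs) (length vs) (\<lambda>(i, j). if (vs ! i, vs ! j) \<in> parcs G then 1 else 0)"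

lemma length_colored_perms: "w \<in> colored_perms m n \<Longrightarrow> length w = n"
  unfolding colored_perms_def
  by (metis (no_types, lifting) length_finite_permutations_of_set card_atLeastAtMost
      diff_Suc_1 length_map mem_Collect_eq)

lemma finite_colored_perms: "finite (colored_perms m n)"
proof (rule finite_subset)
  show "colored_perms m n \<subseteq> {w. set w \<subseteq> {1..n} \<times> {0..<m} \<and> length w = n}"
  proof
    fix w assume w: "w \<in> colored_perms m n"
    then have "fst ` set w = {1..n}" "snd ` set w \<subseteq> {0..<m}"
      by (simp_all add: colored_perms_def permutations_of_set_def)
    then have "set w \<subseteq> {1..n} \<times> {0..<m}"
      using subset_fst_snd[of "set w"] by blast
    with w show "w \<in> {w. set w \<subseteq> {1..n} \<times> {0..<m} \<and> length w = n}"
      by (simp add: length_colored_perms)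
  qed
qed (simp add: finite_lists_length_eq)

lemma flip_in_colored_perms:
  assumes "m > 0" "w \<in> colored_perms m n"
  shows "flip m i w \<in> colored_perms m n"
proof -
  have fst: "map fst (flip m i w) = rev (take i (map fst w)) @ drop i (map fst w)"
    by (simp add: flip_def rev_map take_map drop_map comp_def case_prod_unfold)
  have p: "distinct (map fst w)" "set (map fst w) = {1..n}"
    using assms by (auto simp: colored_perms_def permutations_of_set_def)
  have "distinct (take i (map fst w) @ drop i (map fst w))"
       "set (take i (map fst w) @ drop i (map fst w)) = {1..n}"
    using p by (simp_all only: append_take_drop_id)
  then have "map fst (flip m i w) \<in> permutations_of_set {1..n}"
    unfolding fst permutations_of_set_def
    by (simp only: mem_Collect_eq distinct_append distinct_rev set_append set_rev simp_thms)
  moreover have "set (map snd (flip m i w)) \<subseteq> {0..<m}"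
    using assms
    by (fastforce simp: flip_def colored_perms_def dest: in_set_takeD in_set_dropD)
  ultimately show ?thesis by (simp add: colored_perms_def)
qed

lemma pair_fin_digraph_prefix_reversal_graph:
  assumes "m > 0"
  shows "pair_fin_digraph (prefix_reversal_graph m n)"
proof
  have sub: "parcs (prefix_reversal_graph m n) \<subseteq> colored_perms m n \<times> colored_perms m n"
    using flip_in_colored_perms[OF assms] by (auto simp: prefix_reversal_graph_def)
  then show "finite (parcs (prefix_reversal_graph m n))"
    by (rule finite_subset) (simp add: finite_colored_perms)
  show "fst e \<in> pverts (prefix_reversal_graph m n)" "snd e \<in> pverts (prefix_reversal_graph m n)"
    if "e \<in> parcs (prefix_reversal_graph m n)" for e
    using subsetD[OF sub that] by (auto simp: prefix_reversal_graph_def)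
  show "finite (pverts (prefix_reversal_graph m n))"
    by (simp add: prefix_reversal_graph_def finite_colored_perms)
qed

text \<open>Hence an enumeration of the vertices always exists:\<close>

lemma ex_vertex_enumeration:
  "\<exists>vs. distinct vs \<and> set vs = pverts (prefix_reversal_graph m n)"
  using finite_distinct_list[OF finite_colored_perms[of m n]]
  by (auto simp: prefix_reversal_graph_def)

end

theory Submission
  imports Defs
begin

text \<open>
  The colors and most of the permutation can be forgotten. A flip moves the symbol \<open>1\<close> from one
  position to another in a way that depends on its position alone, so functions of that position
  form an invariant subspace of the adjacency operator. Counting positions from \<open>0\<close>, the flip of
  a prefix of length \<open>i\<close> sends \<open>p\<close> to \<open>i - 1 - p\<close> if \<open>p < i\<close> and fixes it otherwise; the operator
  therefore sends a function \<open>g\<close> of the position to the function with value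
  \<open>p * g p + (\<Sum>q<n - p. g q)\<close> at \<open>p\<close> (\<open>sum_over_flips\<close>). It remains to exhibit, for each \<open>k\<close>,
  a nonzero \<open>g\<close> with \<open>(\<Sum>q<n - p. g q) = (k - p) * g p\<close> for all \<open>p < n\<close>.

  Such a \<open>g\<close> is constant \<open>1\<close> on the interval of positions between \<open>k\<close> and \<open>n - k\<close>, takes at \<open>k\<close>
  the value that makes the total vanish, and is \<open>0\<close> elsewhere (\<open>spike_partial_sum\<close>). For \<open>p\<close>
  outside the interval the partial sum on the left contains nothing or everything and vanishes;
  inside, it is linear in \<open>p\<close> with slope \<open>-1\<close>, like the coefficient \<open>k - p\<close>. The interval is empty
  exactly for \<open>k = \<lfloor>n/2\<rfloor>\<close>, which is why that integer is left out. The case \<open>k = n\<close> fits in: the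
  interval consists of all positions and the point \<open>k\<close> is outside their range.
\<close>

section \<open>Eigenvalues from functions on the vertices\<close>

lemma eigenvalue_adjacency_matrixI:
  fixes f :: "'a \<Rightarrow> complex"
  assumes "distinct vs"
    and "u \<in> set vs" "f u \<noteq> 0"
    and eq: "\<And>w. w \<in> set vs \<Longrightarrow> (\<Sum>v | v \<in> set vs \<and> (w, v) \<in> parcs G. f v) = c * f w"
  shows "c \<in> spectrum (adjacency_matrix G vs)"
proof -
  let ?A = "adjacency_matrix G vs" and ?N = "length vs"
  let ?v = "vec ?N (\<lambda>i. f (vs ! i))"
  have A: "?A \<in> carrier_mat ?N ?N"
    by (simp add: adjacency_matrix_def)
  have "?A *\<^sub>v ?v = c \<cdot>\<^sub>v ?v"
  proof (rule eq_vecI)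
    fix i assume "i < dim_vec (c \<cdot>\<^sub>v ?v)"
    then have i: "i < ?N" by simp
    have "(?A *\<^sub>v ?v) $ i
        = (\<Sum>j<?N. (if (vs ! i, vs ! j) \<in> parcs G then f (vs ! j) else 0))"
      using i by (auto simp: adjacency_matrix_def scalar_prod_def lessThan_atLeast0
          intro!: sum.cong)
    also have "\<dots> = (\<Sum>v\<in>set vs. if (vs ! i, v) \<in> parcs G then f v else 0)"
      by (rule sum.reindex_bij_betw[OF bij_betw_nth[OF \<open>distinct vs\<close>]]) simp_all
    also have "\<dots> = (\<Sum>v | v \<in> set vs \<and> (vs ! i, v) \<in> parcs G. f v)"
      by (simp add: sum.If_cases Collect_conj_eq)
    also have "\<dots> = (c \<cdot>\<^sub>v ?v) $ i"
      using i eq[of "vs ! i"] by simp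
    finally show "(?A *\<^sub>v ?v) $ i = (c \<cdot>\<^sub>v ?v) $ i" .
  qed (simp add: adjacency_matrix_def)
  moreover have "?v \<noteq> 0\<^sub>v ?N"
  proof
    assume zero: "?v = 0\<^sub>v ?N"
    obtain i where i: "i < ?N" "vs ! i = u"
      using \<open>u \<in> set vs\<close> by (auto simp: in_set_conv_nth)
    have "?v $ i = 0" unfolding zero using i by simp
    with i \<open>f u \<noteq> 0\<close> show False by simp
  qed
  ultimately have "eigenvector ?A ?v c"
    using A by (simp add: eigenvector_def)
  then show ?thesis by (auto simp: spectrum_def eigenvalue_def)
qed

section \<open>The position of a symbol under flips\<close>

definition position_of :: "nat \<Rightarrow> colored_word \<Rightarrow> nat" where
  "position_of x w = (THE p. p < length w \<and> fst (w ! p) = x)"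

lemma position_of_eqI:
  assumes "w \<in> colored_perms m n" "p < n" "fst (w ! p) = x"
  shows "position_of x w = p"
proof -
  have "distinct (map fst w)" and len: "length w = n"
    using assms length_colored_perms by (auto simp: colored_perms_def permutations_of_set_def)
  then have unique: "q = p" if "q < n \<and> fst (w ! q) = x" for q
    using that assms(2,3) nth_eq_iff_index_eq[of "map fst w" q p] by auto
  have "p < n \<and> fst (w ! p) = x" using assms by simp
  then show ?thesis
    unfolding position_of_def len using unique by (rule the_equality)
qed

lemma ex_position:
  assumes "w \<in> colored_perms m n" "x \<in> {1..n}"
  obtains p where "p < n" "fst (w ! p) = x"
proof -
  have "x \<in> set (map fst w)"
    using assms by (simp add: colored_perms_def permutations_of_set_def)
  then obtain p where "p < length w" "fst (w ! p) = x"
    by (auto simp: in_set_conv_nth)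
  then show ?thesis
    using that length_colored_perms[OF assms(1)] by simp
qed

lemma length_flip [simp]: "length (flip m i w) = length w"
  by (simp add: flip_def)

lemma fst_flip_nth:
  assumes "i \<le> length w" "q < length w"
  shows "fst (flip m i w ! q) = fst (w ! (if q < i then i - 1 - q else q))"
  using assms by (auto simp: flip_def nth_append rev_nth case_prod_unfold min_def)

lemma position_of_flip:
  assumes "0 < m" "w \<in> colored_perms m n" "i \<in> {1..n}" "p < n" "fst (w ! p) = x"
  shows "position_of x (flip m i w) = (if p < i then i - 1 - p else p)"
  using assms length_colored_perms[OF assms(2)]
  by (intro position_of_eqI[of _ m n] flip_in_colored_perms) (auto simp: fst_flip_nth)

text \<open>
  The adjacency matrix does not count multiple edges, so sums over out-neighbors are sums over
  flips only because distinct flips of a word give distinct words: the longer flip changes the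
  symbol at its last position, while the shorter one leaves it in place.
\<close>

lemma inj_on_flip:
  assumes "w \<in> colored_perms m n"
  shows "inj_on (\<lambda>i. flip m i w) {1..n}"
proof (rule linorder_inj_onI)
  fix i j assume ij: "i < j" "i \<in> {1..n}" "j \<in> {1..n}"
  have len: "length w = n" and dist: "distinct (map fst w)"
    using assms length_colored_perms by (auto simp: colored_perms_def permutations_of_set_def)
  have "fst (flip m i w ! (j - 1)) = fst (w ! (j - 1))"
       "fst (flip m j w ! (j - 1)) = fst (w ! 0)"
    using ij len by (subst fst_flip_nth; auto)+
  moreover have "fst (w ! (j - 1)) \<noteq> fst (w ! 0)"
    using ij len dist nth_eq_iff_index_eq[of "map fst w" "j - 1" 0] by auto
  ultimately show "flip m i w \<noteq> flip m j w" by metis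
qed auto

lemma sum_over_out_neighbors:
  assumes "0 < m" "w \<in> colored_perms m n"
  shows "(\<Sum>v | v \<in> colored_perms m n \<and> (w, v) \<in> parcs (prefix_reversal_graph m n). f v)
       = (\<Sum>i\<in>{1..n}. f (flip m i w))"
proof -
  have "{v. v \<in> colored_perms m n \<and> (w, v) \<in> parcs (prefix_reversal_graph m n)}
      = (\<lambda>i. flip m i w) ` {1..n}"
    using assms flip_in_colored_perms[OF assms] by (auto simp: prefix_reversal_graph_def)
  then show ?thesis
    by (simp only: sum.reindex[OF inj_on_flip[OF assms(2)]] comp_def)
qed

text \<open>
  The \<open>p\<close> shorter flips fix the position \<open>p\<close>; the longer ones carry it to each position
  below \<open>n - p\<close> exactly once.
\<close>

lemma sum_over_flips:
  fixes g :: "nat \<Rightarrow> int"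
  assumes "p < n"
  shows "(\<Sum>i\<in>{1..n}. g (if p < i then i - 1 - p else p)) = int p * g p + (\<Sum>q<n - p. g q)"
proof -
  have split: "{1..n} = {1..p} \<union> {p+1..n}" using assms by auto
  have "(\<Sum>i\<in>{p+1..n}. g (if p < i then i - 1 - p else p)) = (\<Sum>q<n - p. g q)"
    by (rule sum.reindex_bij_witness[of _ "\<lambda>q. q + 1 + p" "\<lambda>i. i - 1 - p"]) auto
  then show ?thesis
    unfolding split by (subst sum.union_disjoint) auto
qed

section \<open>Eigenfunctions of the position\<close>

text \<open>
  The positions between \<open>k\<close> and \<open>n - k\<close>; at most one of the two parts is nonempty. The end point
  \<open>n - k\<close> belongs to the interval only as its lower end: the eigenvalue equation at \<open>p = k\<close> asks
  that the sum over \<open>q < n - k\<close> vanish, so the support of the eigenfunction must lie entirely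
  above or entirely below this cut.
\<close>

definition mirror_interval :: "nat \<Rightarrow> nat \<Rightarrow> nat set" where
  "mirror_interval n k = {k<..<n - k} \<union> {n - k..<k}"

definition spike :: "nat \<Rightarrow> nat \<Rightarrow> nat \<Rightarrow> int" where
  "spike n k p = (if p = k then - int (card (mirror_interval n k))
                  else if p \<in> mirror_interval n k then 1 else 0)"

lemma mirror_interval_nonempty:
  assumes "k \<le> n" "k \<noteq> n div 2"
  obtains p where "p \<in> mirror_interval n k" "p < n" "p \<noteq> k"
proof (cases "k < n div 2")
  case True
  then show ?thesis using that[of "k + 1"] by (auto simp: mirror_interval_def)
next
  case False
  then show ?thesis using assms that[of "n - k"] by (auto simp: mirror_interval_def)
qed

lemma sum_spike:
  "(\<Sum>q<s. spike n k q) = int (card (mirror_interval n k \<inter> {..<s}))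
     - (if k < s then int (card (mirror_interval n k)) else 0)"
proof -
  have "k \<notin> mirror_interval n k" by (auto simp: mirror_interval_def)
  then have "(\<Sum>q<s. spike n k q)
    = (\<Sum>q<s. (if q \<in> mirror_interval n k then 1 else 0)
        - (if q = k then int (card (mirror_interval n k)) else 0))"
    by (intro sum.cong) (auto simp: spike_def)
  also have "\<dots> = (\<Sum>q<s. if q \<in> mirror_interval n k then 1 else 0)
      - (\<Sum>q<s. if q = k then int (card (mirror_interval n k)) else 0)"
    by (rule sum_subtractf)
  also have "(\<Sum>q<s. if q \<in> mirror_interval n k then 1 else 0)
      = int (card (mirror_interval n k \<inter> {..<s}))"
    by (simp add: sum.If_cases Int_commute)
  finally show ?thesis by simp
qed

text \<open>
  The interval together with \<open>k\<close> is \<open>{n - k..k}\<close> if \<open>n < 2 * k\<close>, and \<open>{k..<n - k}\<close> if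
  \<open>2 * k < n\<close>. For \<open>p\<close> above it the sum stops before the support of the spike function; for \<open>p\<close>
  below it the sum exhausts the support, whose total is \<open>0\<close>. For \<open>p\<close> in the interval every
  unit by which \<open>p\<close> grows removes one summand \<open>1\<close>.
\<close>

lemma spike_partial_sum:
  assumes "k \<le> n" "p < n"
  shows "(\<Sum>q<n - p. spike n k q) = (int k - int p) * spike n k p"
proof (cases "n < 2 * k")
  case True
  then have J: "mirror_interval n k = {n - k..<k}"
    by (auto simp: mirror_interval_def)
  have "{n - k..<k} \<inter> {..<n - p} = {n - k..<min k (n - p)}" by auto
  then have sum: "(\<Sum>q<n - p. spike n k q) = int (min k (n - p) - (n - k))
      - (if k < n - p then int (k - (n - k)) else 0)"
    unfolding sum_spike J by simp
  consider "p < n - k" "k < n - p" | "n - k \<le> p" "p < k" | "p = k" | "k < p" by linarith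
  then show ?thesis
    unfolding sum using assms True by cases (simp_all add: spike_def J)
next
  case False
  then have J: "mirror_interval n k = {k<..<n - k}"
    by (auto simp: mirror_interval_def)
  have "{k<..<n - k} \<inter> {..<n - p} = {k<..<min (n - k) (n - p)}" by auto
  then have sum: "(\<Sum>q<n - p. spike n k q) = int (min (n - k) (n - p) - Suc k)
      - (if k < n - p then int (n - k - Suc k) else 0)"
    unfolding sum_spike J by simp
  consider "p < k" | "p = k" | "k < p" "k < n - p" | "k < p" "n - k \<le> p" by linarith
  then show ?thesis
    unfolding sum using assms False by cases (simp_all add: spike_def J)
qed

lemma ex_word_with_position:
  assumes "0 < m" "p < n"
  obtains w where "w \<in> colored_perms m n" "position_of 1 w = p"
proof -
  \<comment> \<open>Flipping a prefix of length \<open>p + 1\<close> of the identity brings the first symbol to \<open>p\<close>.\<close>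
  let ?e = "map (\<lambda>x. (x, 0)) [1..<n + 1]"
  have fst: "map fst ?e = [1..<n + 1]" by (simp add: comp_def)
  have e: "?e \<in> colored_perms m n"
    unfolding colored_perms_def permutations_of_set_def mem_Collect_eq fst
    using assms by (auto simp del: upt_Suc)
  have "position_of 1 (flip m (p + 1) ?e) = p"
    using assms position_of_flip[OF assms(1) e, of "p + 1" 0 1] by (simp del: upt_Suc)
  with flip_in_colored_perms[OF assms(1) e] show ?thesis by (rule that)
qed

theorem theorem5p1:
  fixes m n :: nat and k :: int and vs :: "colored_word list"
  assumes "m > 2" and "n \<ge> 1"
    and "distinct vs" and "set vs = pverts (prefix_reversal_graph m n)"
    and "k \<in> {0..int n} - {\<lfloor>real n / 2\<rfloor>}"
  shows "of_int k \<in> spectrum (adjacency_matrix (prefix_reversal_graph m n) vs)"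
proof -
  have m: "0 < m" using assms by simp
  have vs: "set vs = colored_perms m n"
    using assms by (simp add: prefix_reversal_graph_def)
  obtain l where k: "k = int l" and l: "l \<le> n"
    using assms(5) by (auto elim: nonneg_int_cases)
  have "\<lfloor>real n / 2\<rfloor> = int (n div 2)"
    using floor_divide_of_nat_eq[of n 2, where ?'a = real] by simp
  with assms(5) k have "l \<noteq> n div 2" by auto
  with l obtain p where p: "p \<in> mirror_interval n l" "p < n" "p \<noteq> l"
    by (rule mirror_interval_nonempty)
  obtain u where u: "u \<in> colored_perms m n" "position_of 1 u = p"
    using ex_word_with_position[OF m \<open>p < n\<close>] .
  let ?f = "\<lambda>w. complex_of_int (spike n l (position_of 1 w))"
  show ?thesis
  proof (rule eigenvalue_adjacency_matrixI[OF \<open>distinct vs\<close>])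
    show "u \<in> set vs" using u vs by simp
    show "?f u \<noteq> 0" using u p by (simp add: spike_def)
    fix w assume "w \<in> set vs"
    then have w: "w \<in> colored_perms m n" using vs by simp
    obtain a where a: "a < n" "fst (w ! a) = 1"
      using ex_position[OF w, of 1] \<open>n \<ge> 1\<close> by auto
    have "(\<Sum>v | v \<in> set vs \<and> (w, v) \<in> parcs (prefix_reversal_graph m n). ?f v)
        = (\<Sum>i\<in>{1..n}. ?f (flip m i w))"
      unfolding vs by (rule sum_over_out_neighbors[OF m w])
    also have "\<dots> = of_int (\<Sum>i\<in>{1..n}. spike n l (if a < i then i - 1 - a else a))"
      unfolding of_int_sum
      by (intro sum.cong) (simp_all only: position_of_flip[OF m w _ a])
    also have "\<dots> = of_int (int l * spike n l a)"
      unfolding sum_over_flips[OF a(1)] spike_partial_sum[OF l a(1)]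
      by (simp add: algebra_simps)
    also have "\<dots> = of_int k * ?f w"
      using position_of_eqI[OF w a] k by simp
    finally show "(\<Sum>v | v \<in> set vs \<and> (w, v) \<in> parcs (prefix_reversal_graph m n). ?f v)
        = of_int k * ?f w" .
  qed
qed

end
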